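(* Let $n\ge3$, let $a_1,a_2>0$ and let $s_1,s_2\in\{0,\dots,n-1\}$ be integers; write $p_j=v_{a_j,s_j}$. None of the following holds: (iii) $f_4(p_1)=f_4(p_2)=f_6(p_1)=f_6(p_2)=0$, $f_{8,1}(p_1)f_{8,1}(p_2)<0$ and $f_{8,1}(p_1)f_{8,2}(p_2)-f_{8,2}(p_1)f_{8,1}(p_2)=0$; (iv) $f_4(p_1)=f_4(p_2)=f_6(p_1)=f_6(p_2)=f_{8,1}(p_1)=f_{8,1}(p_2)=0$ and $f_{8,2}(p_1)f_{8,2}(p_2)<0$; (v) $f_4(p_j)=f_6(p_j)=f_{8,1}(p_j)=f_{8,2}(p_j)=0$ for $j=1,2$. When $n=3$, every condition involving $f_{8,2}$ is omitted.
   Context: $v_{a,s} = (a^2+s)^{-1/2}(a,\underbrace{1,\dots,1}_{s},0,\dots,0)\in\mathbb{R}^n$. For exponents $\lambda_1,\dots,\lambda_r$, $m_{(\lambda_1,\dots,\lambda_r)}(x)$ is the sum of all distinct monomials $x_{i_1}^{\lambda_1}\cdots x_{i_r}^{\lambda_r}$ with $i_1,\dots,i_r$ distinct in $\{1,\dots,n\}$ (each distinct monomial once). Define $f_4 = m_{(4)} - \frac{6}{n-1}m_{(2,2)}$; $f_6 = m_{(6)} - \frac{15}{n-1}m_{(2,4)} + \frac{180}{(n-1)(n-2)}m_{(2,2,2)}$; $f_{8,1} = m_{(8)} - \frac{28}{n-1}m_{(2,6)} + \frac{70}{n-1}m_{(4,4)}$; $f_{8,2} = m_{(4,4)} - \frac{6}{n-2}m_{(2,2,4)}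 + \frac{108}{(n-2)(n-3)}m_{(2,2,2,2)}$ (for $n\ge4$). *)

theory Defs
  imports Complex_Main
begin

text \<open>
  A point of \<open>\<real>\<^sup>n\<close> is a function \<open>nat \<Rightarrow> real\<close> of which only the values at the indices
  \<open>1, \<dots>, n\<close> are used. A monomial in \<open>x\<^sub>1, \<dots>, x\<^sub>n\<close> is represented by its exponent vector
  \<open>nat \<Rightarrow> nat\<close>, so that the set below contains each distinct monomial
  \<open>x\<^bsub>i\<^sub>1\<^esub>\<^bsup>\<lambda>\<^sub>1\<^esup> \<cdots> x\<^bsub>i\<^sub>r\<^esub>\<^bsup>\<lambda>\<^sub>r\<^esup>\<close> with distinct \<open>i\<^sub>1, \<dots>, i\<^sub>r\<close> exactly once,
  no matter how many choices of the indices produce it.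
\<close>

definition monomial_exponents :: "nat \<Rightarrow> nat list \<Rightarrow> (nat \<Rightarrow> nat) set" where
  "monomial_exponents n lam =
     (\<lambda>is k. \<Sum>j<length lam. if is ! j = k then lam ! j else 0) `
       {is. length is = length lam \<and> distinct is \<and> set is \<subseteq> {1..n}}"

lemma finite_monomial_exponents: "finite (monomial_exponents n lam)"
proof -
  have "finite {is. set is \<subseteq> {1..n} \<and> length is = length lam}"
    by (rule finite_lists_length_eq) simp
  then have "finite {is. length is = length lam \<and> distinct is \<and> set is \<subseteq> {1..n}}"
    by (rule rev_finite_subset) auto
  then show ?thesis
    unfolding monomial_exponents_def by (rule finite_imageI)
qed

definition msym :: "nat \<Rightarrow> nat list \<Rightarrow> (nat \<Rightarrow> real) \<Rightarrow> real" where
  "msym n lam x = (\<Sum>e\<in>monomial_exponents n lam. \<Prod>k=1..n. x k ^ e k)"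

definition vpt :: "real \<Rightarrow> nat \<Rightarrow> nat \<Rightarrow> real" where
  "vpt a s k = (a\<^sup>2 + real s) powr (-1/2) *
     (if k = 1 then a else if k \<in> {2..s+1} then 1 else 0)"

definition f4 :: "nat \<Rightarrow> (nat \<Rightarrow> real) \<Rightarrow> real" where
  "f4 n x = msym n [4] x - 6 / (real n - 1) * msym n [2,2] x"

definition f6 :: "nat \<Rightarrow> (nat \<Rightarrow> real) \<Rightarrow> real" where
  "f6 n x = msym n [6] x - 15 / (real n - 1) * msym n [2,4] x
     + 180 / ((real n - 1) * (real n - 2)) * msym n [2,2,2] x"

definition f81 :: "nat \<Rightarrow> (nat \<Rightarrow> real) \<Rightarrow> real" where
  "f81 n x = msym n [8] x - 28 / (real n - 1) * msym n [2,6] x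
     + 70 / (real n - 1) * msym n [4,4] x"

text \<open>Meaningful for \<open>n \<ge> 4\<close> only: for \<open>n = 3\<close> the last coefficient divides by zero.\<close>

definition f82 :: "nat \<Rightarrow> (nat \<Rightarrow> real) \<Rightarrow> real" where
  "f82 n x = msym n [4,4] x - 6 / (real n - 2) * msym n [2,2,4] x
     + 108 / ((real n - 2) * (real n - 3)) * msym n [2,2,2,2] x"

end

theory Submission
  imports Defs "HOL-Combinatorics.Permutations"
begin

text \<open>
  The points \<open>p\<^sub>1\<close> and \<open>p\<^sub>2\<close> must coincide. In terms of the power sums \<open>P\<^sub>k = \<Sum>i. x\<^sub>i\<^bsup>2k\<^esup>\<close> and
  \<open>M = n + 2\<close>, the equations \<open>f\<^sub>4 = f\<^sub>6 = 0\<close> say \<open>M P\<^sub>2 = 3 P\<^sub>1\<^sup>2\<close> and \<open>M (M + 2) P\<^sub>3 = 15 P\<^sub>1\<^sup>3\<close>,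
  where \<open>P\<^sub>k\<close> is proportional to \<open>t\<^sup>k + s\<close> with \<open>t = a\<^sup>2\<close>. Eliminating \<open>M\<close> forces \<open>t > 1\<close>; then
  \<open>z = (t + s) / (t\<^sup>2 - t)\<close> is a positive root of a quartic with a single positive root and
  determines \<open>t\<close> and \<open>s\<close>. For \<open>p\<^sub>1 = p\<^sub>2\<close> the two sign conditions are absurd, and a common zero of
  \<open>f\<^sub>8\<^sub>,\<^sub>1\<close> and \<open>f\<^sub>8\<^sub>,\<^sub>2\<close> would require \<open>(M - 3) (M + 8) (M + 10) = 0\<close>. For \<open>n = 3\<close>, \<open>f\<^sub>4\<close> and \<open>f\<^sub>6\<close>
  have no common zero of this shape.
\<close>

subsection \<open>Monomial symmetric functions as polynomials in power sums\<close>

definition distinct_lists :: "nat \<Rightarrow> nat \<Rightarrow> nat list set" where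
  "distinct_lists n r = {is. length is = r \<and> distinct is \<and> set is \<subseteq> {1..n}}"

definition exponent_vector :: "nat list \<Rightarrow> nat list \<Rightarrow> nat \<Rightarrow> nat" where
  "exponent_vector lam is k = (\<Sum>j<length lam. if is ! j = k then lam ! j else 0)"

text \<open>A monomial is counted here once per index tuple producing it. The overcount makes a
  recursion on the exponent list possible and is divided out afterwards.\<close>

definition ordered_msym :: "nat \<Rightarrow> nat list \<Rightarrow> (nat \<Rightarrow> real) \<Rightarrow> real" where
  "ordered_msym n lam x =
     (\<Sum>is\<in>distinct_lists n (length lam). \<Prod>j<length lam. x (is ! j) ^ (lam ! j))"

text \<open>Its order is the multiplicity with which each monomial occurs in
  \<open>ordered_msym\<close>, provided that all exponents are positive.\<close>

definition stabilizer :: "nat list \<Rightarrow> (nat \<Rightarrow> nat) set" where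
  "stabilizer lam = {\<pi>. \<pi> permutes {..<length lam} \<and> (\<forall>j<length lam. lam ! \<pi> j = lam ! j)}"

definition psum :: "nat \<Rightarrow> (nat \<Rightarrow> real) \<Rightarrow> nat \<Rightarrow> real" where
  "psum n x k = (\<Sum>i=1..n. x i ^ k)"

section \<open>Exponent vectors and their fibres\<close>

lemma finite_distinct_lists: "finite (distinct_lists n r)"
proof -
  have "finite {is. set is \<subseteq> {1..n} \<and> length is = r}"
    by (rule finite_lists_length_eq) simp
  then show ?thesis
    unfolding distinct_lists_def by (rule rev_finite_subset) auto
qed

lemma monomial_exponents_eq:
  "monomial_exponents n lam = exponent_vector lam ` distinct_lists n (length lam)"
  unfolding monomial_exponents_def distinct_lists_def exponent_vector_def by (rule refl)

lemma exponent_vector_nth: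
  assumes "distinct is" "length is = length lam" "j < length lam"
  shows "exponent_vector lam is (is ! j) = lam ! j"
proof -
  have "exponent_vector lam is (is ! j) = (\<Sum>i<length lam. if i = j then lam ! i else 0)"
    unfolding exponent_vector_def using assms by (intro sum.cong) (auto simp: nth_eq_iff_index_eq)
  then show ?thesis using assms by simp
qed

text \<open>Since no exponent is zero, the vector still shows which indices occur; hence tuples with
  equal vectors are rearrangements of each other.\<close>

lemma support_exponent_vector:
  assumes "distinct is" "length is = length lam" "0 \<notin> set lam"
  shows "{k. exponent_vector lam is k > 0} = set is"
proof (intro set_eqI iffI)
  fix k assume "k \<in> {k. exponent_vector lam is k > 0}"
  then have "\<exists>j<length lam. is ! j = k"
    unfolding exponent_vector_def by (force intro: ccontr)
  then show "k \<in> set is" using assms(2) by auto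
next
  fix k assume "k \<in> set is"
  then obtain j where "j < length lam" "k = is ! j" using assms(2) by (auto simp: in_set_conv_nth)
  then show "k \<in> {k. exponent_vector lam is k > 0}"
    using exponent_vector_nth[OF assms(1,2)] assms(3) by (auto simp: in_set_conv_nth intro: gr0I)
qed

text \<open>Split each power over the positions and swap the two products; at position
  \<open>j\<close> only the factor with \<open>k = is ! j\<close> differs from 1.\<close>

lemma prod_exponent_vector:
  fixes x :: "nat \<Rightarrow> real"
  assumes "is \<in> distinct_lists n (length lam)"
  shows "(\<Prod>k=1..n. x k ^ exponent_vector lam is k) = (\<Prod>j<length lam. x (is ! j) ^ (lam ! j))"
proof -
  have "(\<Prod>k=1..n. x k ^ exponent_vector lam is k)
      = (\<Prod>k=1..n. \<Prod>j<length lam. x k ^ (if is ! j = k then lam ! j else 0))"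
    unfolding exponent_vector_def by (simp add: power_sum)
  also have "\<dots> = (\<Prod>j<length lam. \<Prod>k=1..n. x k ^ (if is ! j = k then lam ! j else 0))"
    by (rule prod.swap)
  also have "\<dots> = (\<Prod>j<length lam. x (is ! j) ^ (lam ! j))"
  proof (rule prod.cong[OF refl])
    fix j assume "j \<in> {..<length lam}"
    then have "is ! j \<in> {1..n}"
      using assms unfolding distinct_lists_def by (auto simp: subset_iff)
    moreover have "(\<Prod>k=1..n. x k ^ (if is ! j = k then lam ! j else 0))
        = (\<Prod>k=1..n. if is ! j = k then x k ^ (lam ! j) else 1)"
      by (intro prod.cong) auto
    ultimately show "(\<Prod>k=1..n. x k ^ (if is ! j = k then lam ! j else 0)) = x (is ! j) ^ (lam ! j)"
      by simp
  qed
  finally show ?thesis .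
qed

text \<open>
  Every tuple of indices with a given exponent vector is a rearrangement of a fixed one by a
  permutation of the positions that preserves \<open>lam\<close>.
\<close>

lemma card_exponent_fibre:
  assumes "0 \<notin> set lam" and is0: "is0 \<in> distinct_lists n (length lam)"
  shows "card {is \<in> distinct_lists n (length lam). exponent_vector lam is = exponent_vector lam is0}
       = card (stabilizer lam)" (is "card ?F = _")
proof -
  let ?r = "length lam"
  have d0: "distinct is0" "length is0 = ?r" "set is0 \<subseteq> {1..n}"
    using is0 by (auto simp: distinct_lists_def)
  have "bij_betw (\<lambda>\<pi>. permute_list \<pi> is0) (stabilizer lam) ?F"
    unfolding bij_betw_def
  proof (intro conjI set_eqI iffI)
    show "inj_on (\<lambda>\<pi>. permute_list \<pi> is0) (stabilizer lam)"
    proof (rule inj_onI)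
      fix \<pi> \<rho> assume \<pi>: "\<pi> \<in> stabilizer lam" and \<rho>: "\<rho> \<in> stabilizer lam"
        and eq: "permute_list \<pi> is0 = permute_list \<rho> is0"
      have p: "\<pi> permutes {..<?r}" "\<rho> permutes {..<?r}"
        using \<pi> \<rho> by (auto simp: stabilizer_def)
      show "\<pi> = \<rho>"
      proof
        fix j show "\<pi> j = \<rho> j"
        proof (cases "j < ?r")
          case True
          then have "is0 ! \<pi> j = is0 ! \<rho> j"
            using eq p d0 by (metis permute_list_nth)
          moreover have "\<pi> j < ?r" "\<rho> j < ?r"
            using True permutes_in_image[OF p(1)] permutes_in_image[OF p(2)] by auto
          ultimately show ?thesis using d0 by (simp add: nth_eq_iff_index_eq)
        next
          case False
          then show ?thesis using p by (metis lessThan_iff permutes_not_in)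
        qed
      qed
    qed
  next
    fix xs assume "xs \<in> (\<lambda>\<pi>. permute_list \<pi> is0) ` stabilizer lam"
    then obtain \<pi> where \<pi>: "\<pi> permutes {..<?r}" "\<And>j. j < ?r \<Longrightarrow> lam ! \<pi> j = lam ! j"
      and xs: "xs = permute_list \<pi> is0"
      by (auto simp: stabilizer_def)
    have "exponent_vector lam xs k = exponent_vector lam is0 k" for k
    proof -
      have "exponent_vector lam xs k = (\<Sum>j<?r. if is0 ! \<pi> j = k then lam ! \<pi> j else 0)"
        unfolding exponent_vector_def using \<pi> d0
        by (intro sum.cong) (auto simp: xs permute_list_nth)
      also have "\<dots> = exponent_vector lam is0 k"
        unfolding exponent_vector_def
        using sum.permute[OF \<pi>(1), of "\<lambda>j. if is0 ! j = k then lam ! j else 0"]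
        by (simp add: comp_def)
      finally show ?thesis .
    qed
    then show "xs \<in> ?F"
      using \<pi>(1) d0 by (auto simp: xs distinct_lists_def)
  next
    fix xs assume xs: "xs \<in> ?F"
    then have d: "distinct xs" "length xs = ?r" "exponent_vector lam xs = exponent_vector lam is0"
      by (auto simp: distinct_lists_def)
    then have "set xs = set is0"
      using support_exponent_vector[OF _ _ assms(1)] d0 by metis
    then have "mset xs = mset is0"
      using d d0 by (simp add: set_eq_iff_mset_eq_distinct)
    then obtain \<pi> where \<pi>: "\<pi> permutes {..<length is0}" "permute_list \<pi> is0 = xs"
      by (rule mset_eq_permutation)
    \<comment> \<open>The common exponent vector is read at the index \<open>xs ! j\<close> twice,
      as entry \<open>\<pi> j\<close> of \<open>is0\<close> and as entry \<open>j\<close> of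
      \<open>xs\<close>.\<close>
    have "lam ! \<pi> j = lam ! j" if "j < ?r" for j
    proof -
      have "\<pi> j < ?r" using that permutes_in_image[OF \<pi>(1)] d0 by auto
      then have "lam ! \<pi> j = exponent_vector lam is0 (is0 ! \<pi> j)"
        using exponent_vector_nth[OF d0(1,2)] by simp
      also have "is0 ! \<pi> j = xs ! j"
        using \<pi> that d0 by (metis permute_list_nth)
      also have "exponent_vector lam is0 (xs ! j) = lam ! j"
        using exponent_vector_nth[OF d(1,2) that] d(3) by simp
      finally show ?thesis .
    qed
    then show "xs \<in> (\<lambda>\<pi>. permute_list \<pi> is0) ` stabilizer lam"
      using \<pi> d0 by (auto simp: stabilizer_def)
  qed
  then show ?thesis by (simp add: bij_betw_same_card)
qed

text \<open>Group the tuples by exponent vector; all fibres have the same size.\<close>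

lemma ordered_msym_eq_msym:
  assumes "0 \<notin> set lam"
  shows "ordered_msym n lam x = real (card (stabilizer lam)) * msym n lam x"
proof -
  let ?L = "distinct_lists n (length lam)" and ?E = "exponent_vector lam"
  let ?g = "\<lambda>e :: nat \<Rightarrow> nat. \<Prod>k=1..n. x k ^ e k"
  have "ordered_msym n lam x = (\<Sum>is\<in>?L. ?g (?E is))"
    unfolding ordered_msym_def by (intro sum.cong prod_exponent_vector[symmetric] refl)
  also have "\<dots> = (\<Sum>e\<in>?E ` ?L. \<Sum>is\<in>{is \<in> ?L. ?E is = e}. ?g (?E is))"
    by (rule sum.image_gen[OF finite_distinct_lists])
  also have "\<dots> = (\<Sum>e\<in>?E ` ?L. real (card (stabilizer lam)) * ?g e)"
    using card_exponent_fibre[OF assms] by (intro sum.cong) auto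
  also have "\<dots> = real (card (stabilizer lam)) * msym n lam x"
    by (simp add: msym_def monomial_exponents_eq sum_distrib_left)
  finally show ?thesis .
qed

section \<open>Recursion on the exponent list\<close>

lemma distinct_lists_Suc:
  "distinct_lists n (Suc r) = (\<lambda>(is, i). i # is) ` (SIGMA is:distinct_lists n r. {1..n} - set is)"
proof (intro set_eqI iffI)
  fix xs assume xs: "xs \<in> distinct_lists n (Suc r)"
  then obtain i "is" where "xs = i # is"
    by (cases xs) (auto simp: distinct_lists_def)
  then show "xs \<in> (\<lambda>(is, i). i # is) ` (SIGMA is:distinct_lists n r. {1..n} - set is)"
    using xs by (intro image_eqI[of _ _ "(is, i)"]) (auto simp: distinct_lists_def)
qed (auto simp: distinct_lists_def)

lemma ordered_msym_Nil: "ordered_msym n [] x = 1"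
proof -
  have "distinct_lists n 0 = {[]}" by (auto simp: distinct_lists_def)
  then show ?thesis by (simp add: ordered_msym_def)
qed

text \<open>Let the index carrying \<open>k\<close> range over everything, then subtract the cases
  where it hits the index at position \<open>j\<close>; there the two exponents add up.\<close>

lemma ordered_msym_Cons:
  "ordered_msym n (k # lam) x = psum n x k * ordered_msym n lam x
     - (\<Sum>j<length lam. ordered_msym n (lam[j := lam ! j + k]) x)"
proof -
  let ?r = "length lam"
  let ?P = "\<lambda>is. \<Prod>j<?r. x (is ! j) ^ (lam ! j)"
  have inner: "(\<Sum>i\<in>{1..n} - set is. x i ^ k) = psum n x k - (\<Sum>j<?r. x (is ! j) ^ k)"
    if "is \<in> distinct_lists n ?r" for "is"
  proof -
    have d: "distinct is" "length is = ?r" "set is \<subseteq> {1..n}"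
      using that by (auto simp: distinct_lists_def)
    have "(\<Sum>i\<in>set is. x i ^ k) = (\<Sum>j<?r. x (is ! j) ^ k)"
      using d by (simp add: sum.distinct_set_conv_list sum_list_sum_nth atLeast0LessThan)
    then show ?thesis using d by (simp add: sum_diff psum_def)
  qed
  have merge: "x (is ! j) ^ k * ?P is
      = (\<Prod>i<?r. x (is ! i) ^ (lam[j := lam ! j + k] ! i))" if "j < ?r" for "is" j
  proof -
    have "(\<Prod>i<?r. x (is ! i) ^ (lam[j := lam ! j + k] ! i))
        = (\<Prod>i<?r. (if i = j then x (is ! j) ^ k else 1) * x (is ! i) ^ (lam ! i))"
      by (intro prod.cong) (auto simp: nth_list_update power_add)
    then show ?thesis using that by (simp add: prod.distrib)
  qed
  have "ordered_msym n (k # lam) x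
      = (\<Sum>(is, i)\<in>(SIGMA is:distinct_lists n ?r. {1..n} - set is). x i ^ k * ?P is)"
    unfolding ordered_msym_def length_Cons distinct_lists_Suc
    by (subst sum.reindex) (auto simp: inj_on_def case_prod_beta prod.lessThan_Suc_shift
        simp del: prod.lessThan_Suc intro!: sum.cong)
  also have "\<dots> = (\<Sum>is\<in>distinct_lists n ?r. \<Sum>i\<in>{1..n} - set is. x i ^ k * ?P is)"
    by (rule sum.Sigma[symmetric]) (auto simp: finite_distinct_lists)
  also have "\<dots> = (\<Sum>is\<in>distinct_lists n ?r. (psum n x k - (\<Sum>j<?r. x (is ! j) ^ k)) * ?P is)"
    by (intro sum.cong refl) (simp only: inner flip: sum_distrib_right)
  also have "\<dots> = psum n x k * ordered_msym n lam x
      - (\<Sum>is\<in>distinct_lists n ?r. \<Sum>j<?r. x (is ! j) ^ k * ?P is)"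
    by (simp add: ordered_msym_def left_diff_distrib sum_subtractf sum_distrib_left
        sum_distrib_right)
  also have "(\<Sum>is\<in>distinct_lists n ?r. \<Sum>j<?r. x (is ! j) ^ k * ?P is)
      = (\<Sum>j<?r. ordered_msym n (lam[j := lam ! j + k]) x)"
    by (subst sum.swap) (simp add: ordered_msym_def merge)
  finally show ?thesis .
qed

section \<open>Stabilizer orders and explicit formulas\<close>

lemma card_stabilizer_replicate: "card (stabilizer (replicate r k)) = fact r"
proof -
  have "stabilizer (replicate r k) = {\<pi>. \<pi> permutes {..<r}}"
    by (auto simp: stabilizer_def) (metis lessThan_iff nth_replicate permutes_in_image)
  then show ?thesis by (simp add: card_permutations)
qed

text \<open>An exponent occurring nowhere else pins its position, so every stabilizing permutation
  fixes the last position.\<close>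

lemma card_stabilizer_snoc:
  assumes "k \<notin> set lam"
  shows "card (stabilizer (lam @ [k])) = card (stabilizer lam)"
proof -
  let ?r = "length lam"
  have "\<pi> \<in> stabilizer (lam @ [k]) \<longleftrightarrow> \<pi> \<in> stabilizer lam" for \<pi>
  proof
    assume "\<pi> \<in> stabilizer (lam @ [k])"
    then have p: "\<pi> permutes {..<Suc ?r}"
      and e: "\<And>j. j < Suc ?r \<Longrightarrow> (lam @ [k]) ! \<pi> j = (lam @ [k]) ! j"
      by (auto simp: stabilizer_def)
    have last: "\<pi> ?r = ?r"
    proof (rule ccontr)
      assume "\<pi> ?r \<noteq> ?r"
      then have "\<pi> ?r < ?r" using permutes_in_image[OF p, of ?r] by simp
      then show False using e[of ?r] assms by (auto simp: nth_append)
    qed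
    have "\<pi> permutes {..<?r}"
      using p last by (intro permutes_superset[OF p]) (auto simp: less_Suc_eq)
    moreover have "lam ! \<pi> j = lam ! j" if "j < ?r" for j
    proof -
      have "\<pi> j < ?r" using permutes_in_image[OF \<open>\<pi> permutes {..<?r}\<close>, of j] that by simp
      then show ?thesis using e[of j] that by (simp add: nth_append)
    qed
    ultimately show "\<pi> \<in> stabilizer lam" by (simp add: stabilizer_def)
  next
    assume "\<pi> \<in> stabilizer lam"
    then have p: "\<pi> permutes {..<?r}" and e: "\<And>j. j < ?r \<Longrightarrow> lam ! \<pi> j = lam ! j"
      by (auto simp: stabilizer_def)
    have "\<pi> permutes {..<Suc ?r}"
      using p by (rule permutes_subset) auto
    moreover have "(lam @ [k]) ! \<pi> j = (lam @ [k]) ! j" if "j < Suc ?r" for j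
      using that e[of j] permutes_in_image[OF p, of j] permutes_not_in[OF p, of j]
      by (cases "j < ?r") (auto simp: nth_append)
    ultimately show "\<pi> \<in> stabilizer (lam @ [k])" by (simp add: stabilizer_def)
  qed
  then have "stabilizer (lam @ [k]) = stabilizer lam" by blast
  then show ?thesis by simp
qed

lemma msym_psum:
  shows "k > 0 \<Longrightarrow> msym n [k] x = psum n x k"
    and "k > 0 \<Longrightarrow> msym n [k, k] x = ((psum n x k)\<^sup>2 - psum n x (2 * k)) / 2"
    and "\<lbrakk>k > 0; l > 0; k \<noteq> l\<rbrakk> \<Longrightarrow> msym n [k, l] x = psum n x k * psum n x l - psum n x (k + l)"
    and "msym n [2, 2, 2] x = ((psum n x 2)^3 - 3 * psum n x 2 * psum n x 4 + 2 * psum n x 6) / 6"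
    and "msym n [2, 2, 4] x = ((psum n x 2)\<^sup>2 * psum n x 4 - (psum n x 4)\<^sup>2
      - 2 * psum n x 2 * psum n x 6 + 2 * psum n x 8) / 2"
    and "msym n [2, 2, 2, 2] x = ((psum n x 2)^4 - 6 * (psum n x 2)\<^sup>2 * psum n x 4
      + 3 * (psum n x 4)\<^sup>2 + 8 * psum n x 2 * psum n x 6 - 6 * psum n x 8) / 24"
proof -
  note to_msym = ordered_msym_eq_msym[of _ n x]
  have o1: "ordered_msym n [k] x = psum n x k" for k
    by (simp add: ordered_msym_Cons ordered_msym_Nil)
  have o2: "ordered_msym n [k, l] x = psum n x k * psum n x l - psum n x (k + l)" for k l
    by (simp add: ordered_msym_Cons[of n k] o1 add.commute)
  \<comment> \<open>General exponents are needed because the recursion for four 2s merges them into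
    the three arrangements of 4, 2, 2.\<close>
  have o3: "ordered_msym n [k, l, m] x = psum n x k * psum n x l * psum n x m
     - psum n x (k + l) * psum n x m - psum n x (k + m) * psum n x l
     - psum n x (l + m) * psum n x k + 2 * psum n x (k + l + m)" for k l m
    by (simp add: ordered_msym_Cons[of n k] o2 algebra_simps)
  have "ordered_msym n [2, 2, 2, 2] x
      = psum n x 2 * ordered_msym n [2, 2, 2] x - ordered_msym n [4, 2, 2] x
        - ordered_msym n [2, 4, 2] x - ordered_msym n [2, 2, 4] x"
    by (simp add: ordered_msym_Cons[of n 2 "[2, 2, 2]"])
  also have "\<dots> = (psum n x 2)^4 - 6 * (psum n x 2)\<^sup>2 * psum n x 4
     + 3 * (psum n x 4)\<^sup>2 + 8 * psum n x 2 * psum n x 6 - 6 * psum n x 8"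
    by (simp add: o3) algebra
  finally have o4: "ordered_msym n [2, 2, 2, 2] x = \<dots>" .
  have c: "card (stabilizer [k]) = 1" "card (stabilizer [k, k]) = 2"
    "card (stabilizer [k, k, k]) = 6" "card (stabilizer [k, k, k, k]) = 24" for k
    using card_stabilizer_replicate[of 1 k] card_stabilizer_replicate[of 2 k]
      card_stabilizer_replicate[of 3 k] card_stabilizer_replicate[of 4 k]
    by (simp_all add: eval_nat_numeral)
  show "k > 0 \<Longrightarrow> msym n [k] x = psum n x k"
    using to_msym[of "[k]"] by (simp add: o1 c)
  show "k > 0 \<Longrightarrow> msym n [k, k] x = ((psum n x k)\<^sup>2 - psum n x (2 * k)) / 2"
    using to_msym[of "[k, k]"] by (simp add: o2 c power2_eq_square flip: mult_2)
  show "msym n [k, l] x = psum n x k * psum n x l - psum n x (k + l)" if "k > 0" "l > 0" "k \<noteq> l"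
    using to_msym[of "[k, l]"] card_stabilizer_snoc[of l "[k]"] that by (simp add: o2 c)
  show "msym n [2, 2, 2] x = ((psum n x 2)^3 - 3 * psum n x 2 * psum n x 4 + 2 * psum n x 6) / 6"
    using to_msym[of "[2, 2, 2]"] by (simp add: o3 c power3_eq_cube)
  show "msym n [2, 2, 4] x = ((psum n x 2)\<^sup>2 * psum n x 4 - (psum n x 4)\<^sup>2
      - 2 * psum n x 2 * psum n x 6 + 2 * psum n x 8) / 2"
    using to_msym[of "[2, 2, 4]"] card_stabilizer_snoc[of 4 "[2, 2]"]
    by (simp add: o3 c power2_eq_square)
  show "msym n [2, 2, 2, 2] x = ((psum n x 2)^4 - 6 * (psum n x 2)\<^sup>2 * psum n x 4
      + 3 * (psum n x 4)\<^sup>2 + 8 * psum n x 2 * psum n x 6 - 6 * psum n x 8) / 24"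
    using to_msym[of "[2, 2, 2, 2]"] by (simp add: o4 c)
qed

subsection \<open>The moment equations\<close>

text \<open>With \<open>G\<close> the product on the left, \<open>(G z - k) / z\<close> equals
  \<open>k\<close> at a root. It is strictly increasing for positive \<open>z\<close>: its
  \<open>1 / z\<close> term has the negative coefficient \<open>a * d - k\<close>, and the
  coefficients of \<open>z\<close>, \<open>z^2\<close>, \<open>z^3\<close> are nonnegative.\<close>

lemma convex_quadratic_product_unique_root:
  fixes a b c d e f k z w :: real
  assumes "a \<ge> 0" "b \<ge> 0" "c \<ge> 0" "d \<ge> 0" "e \<ge> 0" "f \<ge> 0" "a * d < k"
    and "z > 0" "w > 0"
    and "(a + b * z + c * z\<^sup>2) * (d + e * z + f * z\<^sup>2) = k * (1 + z)"
    and "(a + b * w + c * w\<^sup>2) * (d + e * w + f * w\<^sup>2) = k * (1 + w)"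
  shows "z = w"
proof -
  have no_less: False if "0 < z" "z < w"
    and z: "(a + b * z + c * z\<^sup>2) * (d + e * z + f * z\<^sup>2) = k * (1 + z)"
    and w: "(a + b * w + c * w\<^sup>2) * (d + e * w + f * w\<^sup>2) = k * (1 + w)" for z w
  proof -
    define A B C where "A = a * f + b * e + c * d" and "B = b * f + c * e" and "C = c * f"
    have nonneg: "A \<ge> 0" "B \<ge> 0" "C \<ge> 0" using assms(1-6) by (auto simp: A_def B_def C_def)
    \<comment> \<open>Cross-multiplying cancels the linear coefficient of the product.\<close>
    have "w * (k * (1 + z)) - z * (k * (1 + w))
        = (w - z) * (a * d) - z * w * ((w - z) * A + (w\<^sup>2 - z\<^sup>2) * B + (w^3 - z^3) * C)"
      unfolding z[symmetric] w[symmetric] A_def B_def C_def by algebra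
    moreover have "0 \<le> (w - z) * A + (w\<^sup>2 - z\<^sup>2) * B + (w^3 - z^3) * C"
      using nonneg that(1,2) by (intro add_nonneg_nonneg mult_nonneg_nonneg) (auto simp: power_mono)
    ultimately have "w * (k * (1 + z)) - z * (k * (1 + w)) \<le> (w - z) * (a * d)"
      using that(1,2) by simp
    moreover have "w * (k * (1 + z)) - z * (k * (1 + w)) = (w - z) * k" by algebra
    ultimately show False using that(1,2) assms(7) by (simp add: mult_le_cancel_left)
  qed
  show ?thesis using no_less[of z w] no_less[of w z] assms by (cases z w rule: linorder_cases) auto
qed

text \<open>Here \<open>t\<close> is \<open>a^2\<close> and \<open>M\<close> is
  \<open>n + 2\<close>, so the second conclusion rules out \<open>n = 3\<close>.\<close>

lemma moment_equations_bounds: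
  fixes M t :: real and s :: nat
  assumes M: "M \<ge> 5" and t: "t > 0"
    and m2: "M * (t\<^sup>2 + real s) = 3 * (t + real s)\<^sup>2"
    and m3: "M * (M + 2) * (t^3 + real s) = 15 * (t + real s)^3"
    and sM: "real s \<le> M - 3"
  shows "t > 1" and "M \<noteq> 5"
proof -
  define \<sigma> where "\<sigma> = real s"
  have m2': "M * (t\<^sup>2 + \<sigma>) = 3 * (t + \<sigma>)\<^sup>2"
    and m3': "M * (M + 2) * (t^3 + \<sigma>) = 15 * (t + \<sigma>)^3"
    using m2 m3 by (simp_all add: \<sigma>_def)
  have u: "t + \<sigma> > 0" using t by (simp add: \<sigma>_def)
  have "s \<noteq> 0"
  proof
    assume "s = 0"
    then have "M * t\<^sup>2 = 3 * t\<^sup>2" using m2 by simp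
    then show False using M t by simp
  qed
  then have \<sigma>: "\<sigma> > 0" by (simp add: \<sigma>_def)
  \<comment> \<open>\<open>M\<close> is eliminated in two rounds: the first divides the third-moment
    equation by the second-moment one, the second multiplies by \<open>t^2 + \<sigma>\<close> to
    apply the latter again.\<close>
  have "3 * (t + \<sigma>)\<^sup>2 * ((M + 2) * (t^3 + \<sigma>)) = M * (M + 2) * (t^3 + \<sigma>) * (t\<^sup>2 + \<sigma>)"
    unfolding m2'[symmetric] by (simp add: algebra_simps)
  also have "\<dots> = 3 * (t + \<sigma>)\<^sup>2 * (5 * (t + \<sigma>) * (t\<^sup>2 + \<sigma>))"
    unfolding m3' by (simp add: power2_eq_square power3_eq_cube)
  finally have "(M + 2) * (t^3 + \<sigma>) = 5 * (t + \<sigma>) * (t\<^sup>2 + \<sigma>)"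
    using u by simp
  then have "(M * (t\<^sup>2 + \<sigma>) + 2 * (t\<^sup>2 + \<sigma>)) * (t^3 + \<sigma>) = 5 * (t + \<sigma>) * (t\<^sup>2 + \<sigma>)\<^sup>2"
    by algebra
  then have "(3 * (t + \<sigma>)\<^sup>2 + 2 * (t\<^sup>2 + \<sigma>)) * (t^3 + \<sigma>) = 5 * (t + \<sigma>) * (t\<^sup>2 + \<sigma>)\<^sup>2"
    unfolding m2' .
  then have "\<sigma> * (2 * \<sigma>\<^sup>2 + \<sigma> * (10 * t\<^sup>2 - 3 * t^3 - t - 2) - t\<^sup>2 * (t\<^sup>2 - 8 * t + 5)) = 0"
    by algebra
  then have elim: "2 * \<sigma>\<^sup>2 + \<sigma> * (10 * t\<^sup>2 - 3 * t^3 - t - 2) - t\<^sup>2 * (t\<^sup>2 - 8 * t + 5) = 0"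
    using \<sigma> by simp
  have "s \<noteq> 1"
  proof
    assume "s = 1"
    then have "\<sigma> = 1" by (simp add: \<sigma>_def)
    \<comment> \<open>At \<open>\<sigma> = 1\<close> the eliminant factors, and its only factor that
      can vanish for positive \<open>t\<close> forces \<open>M = 4\<close>.\<close>
    then have "t * (t + 1) * (t\<^sup>2 + 1 - 6 * t) = 0" using elim by algebra
    then have "t\<^sup>2 + 1 = 6 * t" using t by simp
    then have "(M - 4) * (6 * t) = 0" using m2' \<open>\<sigma> = 1\<close> by algebra
    then show False using M t by simp
  qed
  then have \<sigma>2: "\<sigma> \<ge> 2" using \<open>s \<noteq> 0\<close> by (simp add: \<sigma>_def)
  show "t > 1"
  proof (rule ccontr)
    assume "\<not> t > 1"
    then have "t \<le> 1" by simp
    then have t32: "t^3 \<le> t\<^sup>2" using t by (simp add: power_decreasing)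
    have t43: "t^4 \<le> t^3" using t \<open>t \<le> 1\<close> by (simp add: power_decreasing)
    have "7 * t\<^sup>2 - t + 1 = 7 * (t - 1/14)\<^sup>2 + 27/28" by algebra
    then have sq: "7 * t\<^sup>2 - t + 1 > 0" using zero_le_power2[of "t - 1/14"] by linarith
    \<comment> \<open>Both factors are lowered to their values at \<open>\<sigma> = 2\<close>; the
      completed square keeps the lowered second factor positive. The cubic term enters next through
      \<open>t^3 \<le> t^2\<close>.\<close>
    have "2 * (2 + (7 * t\<^sup>2 - t)) \<le> \<sigma> * (2 * (\<sigma> - 1) + (7 * t\<^sup>2 - t))"
      using \<sigma>2 sq by (intro mult_mono) auto
    also have "\<dots> \<le> \<sigma> * (2 * (\<sigma> - 1) + (10 * t\<^sup>2 - 3 * t^3 - t))"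
      using \<sigma> t32 by (intro mult_left_mono) auto
    also have "\<dots> = t^4 - 8 * t^3 + 5 * t\<^sup>2" using elim by algebra
    also have "\<dots> \<le> 5 * t\<^sup>2" using t43 zero_less_power[OF t, of 3] by linarith
    finally have "4 - 2 * t + 9 * t\<^sup>2 \<le> 0" by simp
    moreover have "9 * t\<^sup>2 > 0" using t by simp
    ultimately show False using \<open>t \<le> 1\<close> by linarith
  qed
  show "M \<noteq> 5"
  proof
    assume "M = 5"
    \<comment> \<open>Since \<open>s\<close> is at least 2 and at most \<open>M - 3\<close>, only
      \<open>s = 2\<close> remains. The second moment then gives a quadratic for \<open>t\<close>,
      which reduces the third to \<open>t = 1\<close>.\<close>
    then have s: "real s = 2" using \<sigma>2 sM by (simp add: \<sigma>_def)
    then have t2: "t\<^sup>2 = 6 * t + 1" using m2 \<open>M = 5\<close> by (simp add: power2_sum)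
    have "t^3 = t * t\<^sup>2" by (simp add: power3_eq_cube power2_eq_square)
    also have "\<dots> = t * (6 * t + 1)" by (simp only: t2)
    also have "\<dots> = 6 * t\<^sup>2 + t" by (simp add: algebra_simps power2_eq_square)
    finally have t3: "t^3 = 37 * t + 6" using t2 by simp
    have "(t + 2)^3 = t^3 + 6 * t\<^sup>2 + 12 * t + 8" by algebra
    then have "t = 1" using m3 \<open>M = 5\<close> s t2 t3 by simp
    then show False using \<open>t > 1\<close> by simp
  qed
qed

text \<open>
  With \<open>z = (t + s) / (t\<^sup>2 - t)\<close> the moment equations become linear in \<open>t + s\<close> and in \<open>z t\<close>, and
  eliminating both leaves a quartic in \<open>z\<close> alone.
\<close>

lemma moment_equations_elimination:
  fixes M t s z :: real
  assumes "M > 0" "t > 1" "s \<ge> 0"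
    and m2: "M * (t\<^sup>2 + s) = 3 * (t + s)\<^sup>2"
    and m3: "M * (M + 2) * (t^3 + s) = 15 * (t + s)^3"
    and z: "z = (t + s) / (t\<^sup>2 - t)"
  shows "z > 0"
    and "3 * z * (t + s) = M * (1 + z)"
    and "3 * (M + 2) * (z * t) = 5 * M + (7 * M - 6) * z + 2 * (M - 3) * z\<^sup>2"
    and "(5 * M + (7 * M - 6) * z + 2 * (M - 3) * z\<^sup>2) *
         (5 * M + (4 * M - 12) * z + 2 * (M - 3) * z\<^sup>2) = 3 * M * (M + 2)\<^sup>2 * (1 + z)"
proof -
  define u where "u = t + s"
  have tt: "t\<^sup>2 - t > 0" using assms(2) by (simp add: power2_eq_square)
  show zpos: "z > 0" unfolding z using tt assms(2,3) by simp
  have u: "u = z * (t\<^sup>2 - t)" using tt by (simp add: z u_def)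
  \<comment> \<open>Subtracting \<open>M * u\<close> leaves a multiple of \<open>t^2 - t\<close> on
    the left, while \<open>u\<close> on the right is \<open>z\<close> times that factor, so it
    cancels. The third moment is treated alike, using
    \<open>t^3 - t = (t^2 - t) * (t + 1)\<close>.\<close>
  have "(t\<^sup>2 - t) * M = M * (t\<^sup>2 + s) - M * u" unfolding u_def by algebra
  also have "\<dots> = u * (3 * u - M)" unfolding m2 u_def[symmetric] by algebra
  also have "\<dots> = (t\<^sup>2 - t) * (z * (3 * u - M))" by (subst u) (simp add: mult_ac)
  finally have Mz: "M = z * (3 * u - M)" using tt by simp
  then have lin: "3 * z * u = M * (1 + z)" by algebra
  then show "3 * z * (t + s) = M * (1 + z)" by (simp add: u_def)
  have "(t\<^sup>2 - t) * (M * (M + 2) * (t + 1)) = M * (M + 2) * (t^3 + s) - M * (M + 2) * u"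
    unfolding u_def by algebra
  also have "\<dots> = u * (15 * u\<^sup>2 - M * (M + 2))" unfolding m3 u_def[symmetric] by algebra
  also have "\<dots> = (t\<^sup>2 - t) * (z * (15 * u\<^sup>2 - M * (M + 2)))" by (subst u) (simp add: mult_ac)
  finally have "M * (M + 2) * (t + 1) = z * (15 * u\<^sup>2 - M * (M + 2))" using tt by simp
  then have "3 * z * (M * (M + 2) * (t + 1)) = 5 * (3 * z * u)\<^sup>2 - 3 * z\<^sup>2 * (M * (M + 2))"
    by algebra
  then have "M * (3 * (M + 2) * (z * t)) = M * (5 * M + (7 * M - 6) * z + 2 * (M - 3) * z\<^sup>2)"
    unfolding lin by algebra
  then show zt: "3 * (M + 2) * (z * t) = 5 * M + (7 * M - 6) * z + 2 * (M - 3) * z\<^sup>2"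
    using assms(1) by simp
  \<comment> \<open>The definition of \<open>z\<close>, multiplied by \<open>3 * z\<close>, ties the
    two linear relations together; inserting them leaves only \<open>z\<close> and
    \<open>M\<close>.\<close>
  have "3 * ((z * t) * (z * t - z)) = M * (1 + z)" using lin u by algebra
  then have "(3 * (M + 2) * (z * t)) * (3 * (M + 2) * (z * t) - 3 * (M + 2) * z)
      = 3 * M * (M + 2)\<^sup>2 * (1 + z)"
    by algebra
  then show "(5 * M + (7 * M - 6) * z + 2 * (M - 3) * z\<^sup>2) *
      (5 * M + (4 * M - 12) * z + 2 * (M - 3) * z\<^sup>2) = 3 * M * (M + 2)\<^sup>2 * (1 + z)"
    unfolding zt by (simp add: algebra_simps)
qed

lemma moment_equations_unique:
  fixes M t t' :: real and s s' :: nat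
  assumes M: "M \<ge> 5" and t: "t > 1" and t': "t' > 1"
    and m: "M * (t\<^sup>2 + real s) = 3 * (t + real s)\<^sup>2"
      "M * (M + 2) * (t^3 + real s) = 15 * (t + real s)^3"
    and m': "M * (t'\<^sup>2 + real s') = 3 * (t' + real s')\<^sup>2"
      "M * (M + 2) * (t'^3 + real s') = 15 * (t' + real s')^3"
  shows "t = t'" and "s = s'"
proof -
  define z z' where "z = (t + real s) / (t\<^sup>2 - t)" and "z' = (t' + real s') / (t'\<^sup>2 - t')"
  have M0: "M > 0" using M by simp
  note e = moment_equations_elimination[OF M0 t of_nat_0_le_iff m z_def]
  note e' = moment_equations_elimination[OF M0 t' of_nat_0_le_iff m' z'_def]
  \<comment> \<open>This is the condition \<open>a * d < k\<close> of the root lemma: the constant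
    term \<open>25 * M^2\<close> must stay below the right-hand coefficient.\<close>
  have "3 * M * (M + 2)\<^sup>2 - 5 * M * (5 * M) = M * ((3 * M - 4) * (M - 3))" by algebra
  moreover have "M * ((3 * M - 4) * (M - 3)) > 0" using M by simp
  ultimately have k: "5 * M * (5 * M) < 3 * M * (M + 2)\<^sup>2" by linarith
  have "z = z'"
    by (rule convex_quadratic_product_unique_root[OF _ _ _ _ _ _ k e(1) e'(1) e(4) e'(4)])
      (use M in auto)
  have "z > 0" by (rule e(1))
  have "3 * (M + 2) * (z * t) = 3 * (M + 2) * (z * t')"
    using e(3) e'(3) \<open>z = z'\<close> by simp
  then show "t = t'" using \<open>z > 0\<close> M by simp
  have "3 * z * (t + real s) = 3 * z * (t' + real s')" using e(2) e'(2) \<open>z = z'\<close> by simp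
  then have "t + real s = t' + real s'" using \<open>z > 0\<close> by simp
  then show "s = s'" using \<open>t = t'\<close> by simp
qed

subsection \<open>Common zeros of the forms\<close>

lemma clear_denominators:
  fixes A B C c d k l :: real
  assumes "c \<noteq> 0" "d \<noteq> 0"
  shows "c * (A - k / c * B + l / c * C) = c * A - k * B + l * C"
    and "c * d * (A - k / c * B + l / (c * d) * C) = c * d * A - k * d * B + l * C"
proof -
  have *: "c * (k / c * B) = k * B" "c * (l / c * C) = l * C" using assms by simp_all
  show "c * (A - k / c * B + l / c * C) = c * A - k * B + l * C"
    by (simp only: distrib_left right_diff_distrib *)
  have "c * d * (l / (c * d) * C) = l * C" using assms by simp
  moreover have "c * d * (k / c * B) = k * d * B" using assms by simp
  ultimately show "c * d * (A - k / c * B + l / (c * d) * C) = c * d * A - k * d * B + l * C"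
    by (simp only: distrib_left right_diff_distrib)
qed

text \<open>The shift \<open>M = n + 2\<close> makes the coefficients factor; \<open>M - 3\<close>,
  \<open>M - 4\<close>, \<open>M - 5\<close> are \<open>n - 1\<close>, \<open>n - 2\<close>,
  \<open>n - 3\<close>. The extra 2 for \<open>f82\<close> clears the halves coming from
  \<open>msym\<close>.\<close>

lemma forms_psum:
  fixes n :: nat and x :: "nat \<Rightarrow> real"
  defines "M \<equiv> real n + 2"
    and "P \<equiv> psum n x 2" and "Q \<equiv> psum n x 4" and "R \<equiv> psum n x 6" and "S \<equiv> psum n x 8"
  shows "n \<ge> 3 \<Longrightarrow> (M - 3) * f4 n x = M * Q - 3 * P\<^sup>2"
    and "n \<ge> 3 \<Longrightarrow> (M - 3) * (M - 4) * f6 n x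
      = (M + 2) * (M + 6) * R - 15 * (M + 2) * (P * Q) + 30 * P^3"
    and "n \<ge> 3 \<Longrightarrow> (M - 3) * f81 n x = (M - 10) * S - 28 * (P * R) + 35 * Q\<^sup>2"
    and "n \<ge> 4 \<Longrightarrow> 2 * ((M - 4) * (M - 5) * f82 n x) = (M - 4) * (M - 5) * (Q\<^sup>2 - S)
      - 6 * (M - 5) * (P\<^sup>2 * Q - 2 * P * R - Q\<^sup>2 + 2 * S)
      + 9 * (P^4 - 6 * P\<^sup>2 * Q + 3 * Q\<^sup>2 + 8 * P * R - 6 * S)"
proof -
  have n: "real n = M - 2" by (simp add: M_def)
  note defs = P_def Q_def R_def S_def
  {
    assume "n \<ge> 3"
    then have M: "M - 3 \<noteq> 0" "M - 4 \<noteq> 0" by (auto simp: M_def)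
    have "(M - 3) * f4 n x = (M - 3) * msym n [4] x - 6 * msym n [2,2] x"
      unfolding f4_def n using clear_denominators(1)[OF M, of _ 6 _ 0] by simp
    also have "\<dots> = M * Q - 3 * P\<^sup>2"
      by (simp add: msym_psum defs field_simps)
    finally show "(M - 3) * f4 n x = M * Q - 3 * P\<^sup>2" .
    have "(M - 3) * (M - 4) * f6 n x = (M - 3) * (M - 4) * msym n [6] x
        - 15 * (M - 4) * msym n [2,4] x + 180 * msym n [2,2,2] x"
      unfolding f6_def n using clear_denominators(2)[OF M] by simp
    also have "\<dots> = (M - 3) * (M - 4) * R - 15 * (M - 4) * (P * Q - R)
        + 30 * (P^3 - 3 * P * Q + 2 * R)"
      by (simp add: msym_psum defs)
    also have "\<dots> = (M + 2) * (M + 6) * R - 15 * (M + 2) * (P * Q) + 30 * P^3" by algebra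
    finally show "(M - 3) * (M - 4) * f6 n x = \<dots>" .
    have "(M - 3) * f81 n x = (M - 3) * msym n [8] x - 28 * msym n [2,6] x + 70 * msym n [4,4] x"
      unfolding f81_def n using clear_denominators(1)[OF M] by simp
    also have "\<dots> = (M - 10) * S - 28 * (P * R) + 35 * Q\<^sup>2"
      by (simp add: msym_psum defs field_simps)
    finally show "(M - 3) * f81 n x = \<dots>" .
  }
  assume "n \<ge> 4"
  then have M: "M - 4 \<noteq> 0" "M - 5 \<noteq> 0" by (auto simp: M_def)
  have "(M - 4) * (M - 5) * f82 n x = (M - 4) * (M - 5) * msym n [4,4] x
      - 6 * (M - 5) * msym n [2,2,4] x + 108 * msym n [2,2,2,2] x"
    unfolding f82_def n using clear_denominators(2)[OF M] by simp
  then show "2 * ((M - 4) * (M - 5) * f82 n x) = (M - 4) * (M - 5) * (Q\<^sup>2 - S)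
      - 6 * (M - 5) * (P\<^sup>2 * Q - 2 * P * R - Q\<^sup>2 + 2 * S)
      + 9 * (P^4 - 6 * P\<^sup>2 * Q + 3 * Q\<^sup>2 + 8 * P * R - 6 * S)"
    by (simp add: msym_psum defs field_simps)
qed

text \<open>After scaling by \<open>M^2 * (M + 2)\<close>, \<open>Q\<close> and \<open>R\<close> can
  be replaced by powers of \<open>P\<close>. What remains are two linear equations in
  \<open>P^4\<close> and the scaled \<open>S\<close>, with nonzero determinant.\<close>

lemma f8_forms_independent:
  fixes M P Q R S :: real
  assumes M: "M \<ge> 6" and f4: "M * Q = 3 * P\<^sup>2" and f6: "M * (M + 2) * R = 15 * P^3"
    and f81: "(M - 10) * S - 28 * (P * R) + 35 * Q\<^sup>2 = 0"
    and f82: "(M - 4) * (M - 5) * (Q\<^sup>2 - S)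
      - 6 * (M - 5) * (P\<^sup>2 * Q - 2 * P * R - Q\<^sup>2 + 2 * S)
      + 9 * (P^4 - 6 * P\<^sup>2 * Q + 3 * Q\<^sup>2 + 8 * P * R - 6 * S) = 0"
  shows "P = 0"
proof -
  have "M\<^sup>2 * (M + 2) * ((M - 10) * S - 28 * (P * R) + 35 * Q\<^sup>2)
      = M\<^sup>2 * (M + 2) * (M - 10) * S - 28 * M * P * (M * (M + 2) * R) + 35 * (M + 2) * (M * Q)\<^sup>2"
    by algebra
  also have "\<dots> = (M - 10) * (M\<^sup>2 * (M + 2) * S) - 105 * (M - 6) * P^4"
    unfolding f4 f6 by algebra
  finally have e1': "(M - 10) * (M\<^sup>2 * (M + 2) * S) = 105 * (M - 6) * P^4"
    using f81 by simp
  have "0 = M\<^sup>2 * (M + 2) * ((M - 4) * (M - 5) * (Q\<^sup>2 - S)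
      - 6 * (M - 5) * (P\<^sup>2 * Q - 2 * P * R - Q\<^sup>2 + 2 * S)
      + 9 * (P^4 - 6 * P\<^sup>2 * Q + 3 * Q\<^sup>2 + 8 * P * R - 6 * S))"
    using f82 by simp
  also have "\<dots> = (M + 2) * ((M - 4) * (M - 5) + 6 * (M - 5) + 27) * (M * Q)\<^sup>2
      - M * (M + 2) * (6 * (M - 5) + 54) * P\<^sup>2 * (M * Q)
      + M * (12 * (M - 5) + 72) * P * (M * (M + 2) * R)
      + 9 * M\<^sup>2 * (M + 2) * P^4 - (M\<^sup>2 + 3 * M + 14) * (M\<^sup>2 * (M + 2) * S)"
    by algebra
  also have "\<dots> = 9 * (9 * M\<^sup>2 + 15 * M + 34) * P^4 - (M\<^sup>2 + 3 * M + 14) * (M\<^sup>2 * (M + 2) * S)"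
    unfolding f4 f6 by algebra
  finally have e2: "9 * (9 * M\<^sup>2 + 15 * M + 34) * P^4 = (M\<^sup>2 + 3 * M + 14) * (M\<^sup>2 * (M + 2) * S)"
    by simp
  \<comment> \<open>\<open>S\<close> is eliminated by cross-multiplication, as \<open>M - 10\<close>
    vanishes for \<open>n = 8\<close>.\<close>
  have "(M - 10) * (9 * (9 * M\<^sup>2 + 15 * M + 34) * P^4)
      = (M\<^sup>2 + 3 * M + 14) * (105 * (M - 6) * P^4)"
    unfolding e2 e1'[symmetric] by (simp only: mult_ac)
  then have "24 * ((M - 3) * (M + 8) * (M + 10)) * P^4 = 0" by algebra
  then show "P = 0" using M by simp
qed

section \<open>Evaluation at the points and conclusion\<close>

text \<open>Since \<open>s < n\<close>, all \<open>s\<close> unit coordinates fit into positions up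
  to \<open>n\<close>; since \<open>k > 0\<close>, the zero coordinates contribute nothing.\<close>

lemma psum_vpt:
  assumes "s < n" and "k > 0"
  shows "psum n (vpt a s) k = ((a\<^sup>2 + real s) powr (-1/2))^k * (a^k + real s)"
proof -
  let ?w = "(a\<^sup>2 + real s) powr (-1/2)"
  have "psum n (vpt a s) k = ?w^k * (\<Sum>i=1..n. (if i = 1 then a else if i \<in> {2..s+1} then 1 else 0)^k)"
    by (simp add: psum_def vpt_def power_mult_distrib sum_distrib_left)
  also have "(\<Sum>i=1..n. (if i = 1 then a else if i \<in> {2..s+1} then 1 else 0)^k)
      = a^k + (\<Sum>i\<in>{2..n}. if i \<in> {2..s+1} then 1 else 0)"
    using assms by (subst sum.atLeast_Suc_atMost) (auto simp: numeral_2_eq_2 zero_power intro!: sum.cong)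
  also have "(\<Sum>i\<in>{2..n}. if i \<in> {2..s+1} then 1 else (0::real)) = real (card ({2..n} \<inter> {2..s+1}))"
    by (subst sum.inter_restrict[symmetric]) auto
  also have "{2..n} \<inter> {2..s+1} = {2..s+1}" using assms(1) by auto
  finally show ?thesis by simp
qed

theorem theorem5p7:
  fixes n s1 s2 :: nat and a1 a2 :: real and p1 p2 :: "nat \<Rightarrow> real"
  assumes "n \<ge> 3"
    and "a1 > 0" and "a2 > 0"
    and "s1 \<in> {0..n-1}" and "s2 \<in> {0..n-1}"
    and "p1 = vpt a1 s1" and "p2 = vpt a2 s2"
  shows "\<not> (f4 n p1 = 0 \<and> f4 n p2 = 0 \<and> f6 n p1 = 0 \<and> f6 n p2 = 0 \<and>
            f81 n p1 * f81 n p2 < 0 \<and>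
            (n \<ge> 4 \<longrightarrow> f81 n p1 * f82 n p2 - f82 n p1 * f81 n p2 = 0)) \<and>
         \<not> (f4 n p1 = 0 \<and> f4 n p2 = 0 \<and> f6 n p1 = 0 \<and> f6 n p2 = 0 \<and>
            f81 n p1 = 0 \<and> f81 n p2 = 0 \<and>
            (n \<ge> 4 \<longrightarrow> f82 n p1 * f82 n p2 < 0)) \<and>
         \<not> (\<forall>p\<in>{p1, p2}. f4 n p = 0 \<and> f6 n p = 0 \<and> f81 n p = 0 \<and>
            (n \<ge> 4 \<longrightarrow> f82 n p = 0))"
\<comment> \<open>These four equations are part of each excluded condition, so their failure settles
  all three.\<close>
proof (cases "f4 n p1 = 0 \<and> f4 n p2 = 0 \<and> f6 n p1 = 0 \<and> f6 n p2 = 0")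
  case True
  define M where "M = real n + 2"
  have M: "M \<ge> 5" "M - 3 \<noteq> 0" "M - 4 \<noteq> 0" "M + 6 \<noteq> 0" using assms(1) by (auto simp: M_def)
  note forms = forms_psum[of n, folded M_def]
  have psums: "M * psum n x 4 = 3 * (psum n x 2)\<^sup>2 \<and>
      M * (M + 2) * psum n x 6 = 15 * (psum n x 2)^3"
    if "f4 n x = 0" "f6 n x = 0" for x
  proof
    show Q: "M * psum n x 4 = 3 * (psum n x 2)\<^sup>2" using forms(1)[OF assms(1), of x] that by simp
    have "(M + 2) * (M + 6) * psum n x 6 - 15 * (M + 2) * (psum n x 2 * psum n x 4)
        + 30 * (psum n x 2)^3 = 0"
      using forms(2)[OF assms(1), of x] that by simp
    \<comment> \<open>Multiplying by \<open>M\<close> and replacing \<open>M * Q\<close> lets the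
      factor \<open>M + 6\<close> split off.\<close>
    then have "(M + 6) * (M * (M + 2) * psum n x 6 - 15 * (psum n x 2)^3) = 0"
      using Q by algebra
    then show "M * (M + 2) * psum n x 6 = 15 * (psum n x 2)^3" using M by simp
  qed
  have vpt: "M * ((a\<^sup>2)\<^sup>2 + real s) = 3 * (a\<^sup>2 + real s)\<^sup>2 \<and>
      M * (M + 2) * ((a\<^sup>2)^3 + real s) = 15 * (a\<^sup>2 + real s)^3 \<and> psum n (vpt a s) 2 \<noteq> 0"
    if "a > 0" "s < n" "f4 n (vpt a s) = 0" "f6 n (vpt a s) = 0" for a s
  proof (intro conjI)
    define w where "w = (a\<^sup>2 + real s) powr (-1/2)"
    have pos: "a\<^sup>2 + real s > 0" using that(1) by (simp add: add_pos_nonneg)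
    then have w: "w \<noteq> 0" by (simp add: w_def)
    have p: "psum n (vpt a s) 2 = w^2 * (a\<^sup>2 + real s)"
      "psum n (vpt a s) 4 = w^4 * ((a\<^sup>2)\<^sup>2 + real s)"
      "psum n (vpt a s) 6 = w^6 * ((a\<^sup>2)^3 + real s)"
      using psum_vpt[OF that(2), of _ a] by (simp_all add: w_def flip: power_mult)
    note eqs = psums[OF that(3,4), unfolded p]
    \<comment> \<open>Both relations are homogeneous, of degrees 4 and 6, so the normalizing factor
      \<open>w\<close> cancels.\<close>
    have "w^4 * (M * ((a\<^sup>2)\<^sup>2 + real s)) = w^4 * (3 * (a\<^sup>2 + real s)\<^sup>2)"
      using eqs by algebra
    then show "M * ((a\<^sup>2)\<^sup>2 + real s) = 3 * (a\<^sup>2 + real s)\<^sup>2" using w by simp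
    have "w^6 * (M * (M + 2) * ((a\<^sup>2)^3 + real s)) = w^6 * (15 * (a\<^sup>2 + real s)^3)"
      using eqs by algebra
    then show "M * (M + 2) * ((a\<^sup>2)^3 + real s) = 15 * (a\<^sup>2 + real s)^3" using w by simp
    show "psum n (vpt a s) 2 \<noteq> 0" using w pos p(1) by simp
  qed
  have s: "s1 < n" "s2 < n" using assms(1,4,5) by auto
  then have sM: "real s1 \<le> M - 3" "real s2 \<le> M - 3" by (auto simp: M_def)
  note v1 = vpt[OF assms(2) s(1)] and v2 = vpt[OF assms(3) s(2)]
  have m1: "M * ((a1\<^sup>2)\<^sup>2 + real s1) = 3 * (a1\<^sup>2 + real s1)\<^sup>2"
      "M * (M + 2) * ((a1\<^sup>2)^3 + real s1) = 15 * (a1\<^sup>2 + real s1)^3"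
    and m2: "M * ((a2\<^sup>2)\<^sup>2 + real s2) = 3 * (a2\<^sup>2 + real s2)\<^sup>2"
      "M * (M + 2) * ((a2\<^sup>2)^3 + real s2) = 15 * (a2\<^sup>2 + real s2)^3"
    and P: "psum n p1 2 \<noteq> 0"
    using v1 v2 True assms(6,7) by auto
  have "a1\<^sup>2 > 0" "a2\<^sup>2 > 0" using assms(2,3) by auto
  note b1 = moment_equations_bounds[OF M(1) this(1) m1 sM(1)]
    and b2 = moment_equations_bounds[OF M(1) this(2) m2 sM(2)]
  have "a1\<^sup>2 = a2\<^sup>2" "s1 = s2"
    using moment_equations_unique[OF M(1) b1(1) b2(1) m1 m2] by auto
  \<comment> \<open>Positivity of \<open>a1\<close> and \<open>a2\<close> recovers them from their
    squares.\<close>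
  then have eq: "p1 = p2" using assms(2,3,6,7) by simp
  \<comment> \<open>From here on the clauses about \<open>f82\<close> are in force.\<close>
  have n: "n \<ge> 4" using b1(2) assms(1) by (simp add: M_def)
  then have M6: "M \<ge> 6" by (simp add: M_def)
  have "\<not> (f81 n p1 = 0 \<and> f82 n p1 = 0)"
  proof
    assume f8: "f81 n p1 = 0 \<and> f82 n p1 = 0"
    show False
      using f8_forms_independent[OF M6, of "psum n p1 4" "psum n p1 2" "psum n p1 6" "psum n p1 8"]
        psums[of p1] forms(3)[OF assms(1), of p1] forms(4)[OF n, of p1] f8 True P by simp
  qed
  \<comment> \<open>With equal points the first two conditions would make a square negative; the
    third contradicts the fact just shown.\<close>
  then show ?thesis using n by (auto simp: eq not_less zero_le_mult_iff)
qed auto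

end
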